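(* Let $\sigma\in(0,1)$. For every measurable $E\subseteq\mathbb{R}^d$, $H^\sigma_R(E)$ is monotonically non-decreasing with respect to $R\in(0,+\infty)$ and tends to $H^\sigma(E)$ as $R\to+\infty$. Moreover, $\gamma^\sigma_R$ is monotonically increasing with respect to $R$ and tends to $\gamma^\sigma$ as $R\to+\infty$. As a consequence, $$\hat H^\sigma(E)=\lim_{R\to+\infty}\hat H^\sigma_R(E)\qquad\text{for all }E\in\mathcal{M}_{\mathrm f}(\mathbb{R}^d).$$ Furthermore, for every $E\in\mathcal{M}_{\mathrm f}(\mathbb{R}^d)$, $\hat H^\sigma_R(E)$ is monotonically non-increasing with respect to $R$, and for every $R>1$ (and every $\sigma\in(0,1)$), $$\hat H^\sigma(E)\le\hat H^\sigma_R(E)\le\hat H^\sigma(E)+\frac{|E|^2}{R^{d+\sigma}}\qquad\text{for all }E\in\mathcal{M}_{\mathrm f}(\mathbb{R}^d).$$ Finally, $\hat H^\sigma$ is the $\Gamma$-limit of the functionals $\hat H^\sigma_R$ as $R\to+\infty$ with respect to the strong $L^1$ convergence of characteristic functions.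
   Context: Let $d\ge1$, let $|E|$ denote Lebesgue measure in $\mathbb{R}^d$, $\omega_d$ the measure of the unit ball, $B_\rho(x)$ the ball of radius $\rho$ and center $x$, and $\chi_E$ the characteristic function of $E$. $\mathcal{M}_{\mathrm f}(\mathbb{R}^d)$ is the family of measurable sets $E\subset\mathbb{R}^d$ with $|E|<+\infty$. For $\sigma\in(0,1)$, $R>0$ and measurable $E$ set $$\gamma^\sigma_R:=d\omega_d\frac{1-R^{-\sigma}}{\sigma},\qquad\gamma^\sigma:=\frac{d\omega_d}{\sigma},$$ $$H^\sigma_R(E):=\int_E\int_{B_R(x)\setminus E}\frac{1}{|x-y|^{d+\sigma}}\,dy\,dx,\qquad H^\sigma(E):=\int_E\int_{\mathbb{R}^d\setminus E}\frac{1}{|x-y|^{d+\sigma}}\,dy\,dx,$$ with values in $[0,+\infty]$, and for $E\in\mathcal{M}_{\mathrm f}(\mathbb{R}^d)$ set $\hat H^\sigma_R(E):=H^\sigma_R(E)-\gamma^\sigma_R|E|$ and $\hat H^\sigma(E):=H^\sigma(E)-\gamma^\sigma|E|$, with values in $(-\infty,+\infty]$. $\Gamma$-convergence as $R\to+\infty$ is understood on $\mathcal{M}_{\mathrm f}(\mathbb{R}^d)$, with convergence $E_n\to E$ meaning $\chi_{E_n}\to\chi_E$ in $L^1(\mathbb{R}^d)$: for every sequence $R_n\to+\infty$, (liminf) $\hat H^\sigma(E)\le\liminf_n\hat H^\sigma_{R_n}(E_n)$ whenever $E_n\to E$, and (limsup) for every $E$ there is $E_n\to E$ with $\hat H^\sigma(E)\ge\limsup_n\hat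 H^\sigma_{R_n}(E_n)$. *)

theory Defs
  imports "HOL-Analysis.Analysis"
begin

text \<open>
  The ambient space is an arbitrary Euclidean space of dimension \<open>DIM('a) \<ge> 1\<close> with (complete)
  Lebesgue measure; the family of measurable sets of finite measure is the library's \<open>lmeasurable\<close>.
  The constants \<open>gamma_trunc\<close> and \<open>gamma_full\<close> depend on the space only through its dimension and
  therefore take a type argument.
\<close>

definition omega :: "'a::euclidean_space itself \<Rightarrow> real" where
  "omega _ = measure lebesgue (ball (0::'a) 1)"

definition gamma_trunc :: "'a::euclidean_space itself \<Rightarrow> real \<Rightarrow> real \<Rightarrow> real" where
  "gamma_trunc T \<sigma> R = real DIM('a) * omega T * ((1 - R powr (- \<sigma>)) / \<sigma>)"

definition gamma_full :: "'a::euclidean_space itself \<Rightarrow> real \<Rightarrow> real" where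
  "gamma_full T \<sigma> = real DIM('a) * omega T / \<sigma>"

definition kernel :: "real \<Rightarrow> 'a::euclidean_space \<Rightarrow> 'a \<Rightarrow> real" where
  "kernel \<sigma> x y = 1 / norm (x - y) powr (real DIM('a) + \<sigma>)"

definition H_trunc :: "real \<Rightarrow> real \<Rightarrow> 'a::euclidean_space set \<Rightarrow> ennreal" where
  "H_trunc \<sigma> R E =
    (\<integral>\<^sup>+x\<in>E. (\<integral>\<^sup>+y\<in>ball x R - E. ennreal (kernel \<sigma> x y) \<partial>lebesgue) \<partial>lebesgue)"

definition H_full :: "real \<Rightarrow> 'a::euclidean_space set \<Rightarrow> ennreal" where
  "H_full \<sigma> E =
    (\<integral>\<^sup>+x\<in>E. (\<integral>\<^sup>+y\<in>UNIV - E. ennreal (kernel \<sigma> x y) \<partial>lebesgue) \<partial>lebesgue)"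

text \<open>
  The renormalized functionals are meant for \<open>E \<in> lmeasurable\<close>, where \<open>measure lebesgue E\<close> is
  the true measure of \<open>E\<close>; the value is never \<open>-\<infinity>\<close>.
\<close>

definition Hhat_trunc :: "real \<Rightarrow> real \<Rightarrow> 'a::euclidean_space set \<Rightarrow> ereal" where
  "Hhat_trunc \<sigma> R E =
    enn2ereal (H_trunc \<sigma> R E) - ereal (gamma_trunc TYPE('a) \<sigma> R * measure lebesgue E)"

definition Hhat_full :: "real \<Rightarrow> 'a::euclidean_space set \<Rightarrow> ereal" where
  "Hhat_full \<sigma> E =
    enn2ereal (H_full \<sigma> E) - ereal (gamma_full TYPE('a) \<sigma> * measure lebesgue E)"

definition L1_conv :: "(nat \<Rightarrow> 'a::euclidean_space set) \<Rightarrow> 'a set \<Rightarrow> bool" where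
  "L1_conv En E \<longleftrightarrow>
    (\<lambda>n. \<integral>\<^sup>+x. ennreal \<bar>indicat_real (En n) x - indicat_real E x\<bar> \<partial>lebesgue) \<longlonglongrightarrow> 0"

text \<open>
  Sequential \<open>\<Gamma>\<close>-convergence on \<open>X\<close>, as the parameter \<open>R > 0\<close> tends to infinity, of the family
  \<open>F R\<close> to \<open>G\<close>, with respect to the notion \<open>conv\<close> of convergence of sequences in \<open>X\<close>.
\<close>

definition Gamma_limit_at_top ::
  "'x set \<Rightarrow> ((nat \<Rightarrow> 'x) \<Rightarrow> 'x \<Rightarrow> bool) \<Rightarrow> (real \<Rightarrow> 'x \<Rightarrow> ereal) \<Rightarrow> ('x \<Rightarrow> ereal) \<Rightarrow> bool" where
  "Gamma_limit_at_top X conv F G \<longleftrightarrow>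
    (\<forall>R :: nat \<Rightarrow> real. (\<forall>n. 0 < R n) \<longrightarrow> filterlim R at_top sequentially \<longrightarrow>
      (\<forall>x\<in>X. \<forall>u. (\<forall>n. u n \<in> X) \<longrightarrow> conv u x \<longrightarrow> G x \<le> liminf (\<lambda>n. F (R n) (u n))) \<and>
      (\<forall>x\<in>X. \<exists>u. (\<forall>n. u n \<in> X) \<and> conv u x \<and> limsup (\<lambda>n. F (R n) (u n)) \<le> G x))"

end

theory Submission
  imports Defs
begin

text \<open>
  Over the complement of any ball of radius \<open>R\<close> centred at \<open>x\<close>, the kernel has integral
  \<open>gamma_full - gamma_trunc\<close>. Hence the renormalized truncated functional exceeds the full one by
  exactly the interaction of \<open>E\<close> with itself at distance at least \<open>R\<close>, which is non-increasing in
  \<open>R\<close> and at most \<open>|E|\<^sup>2 / R powr (d + \<sigma>)\<close>. The liminf inequality thus reduces to the lower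
  semicontinuity of the full functional (Fatou along an almost everywhere convergent subsequence,
  and continuity of the measure), and constant sequences are recovery sequences.
\<close>

section \<open>Measurability of the kernel and of its partial integrals\<close>

text \<open>Completion keeps the measure of Borel sets, so a countable cover by sets of finite
  \<open>lborel\<close> measure still serves. This is what makes partial integrals over the complete
  measure measurable in the remaining variable.\<close>

lemma sigma_finite_lebesgue: "sigma_finite_measure (lebesgue :: 'a::euclidean_space measure)"
proof
  obtain A :: "'a set set" where A: "countable A" "A \<subseteq> sets lborel" "\<Union>A = space lborel"
      "\<forall>a\<in>A. emeasure lborel a \<noteq> \<infinity>"
    using lborel.sigma_finite_countable by blast
  show "\<exists>A::'a set set. countable A \<and> A \<subseteq> sets lebesgue \<and> \<Union>A = space lebesgue \<and>
      (\<forall>a\<in>A. emeasure lebesgue a \<noteq> \<infinity>)"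
    using A by (intro exI[of _ A]) auto
qed

lemma omega_eq: "omega TYPE('a::euclidean_space) = unit_ball_vol (real DIM('a))"
  unfolding omega_def by (simp add: content_ball)

lemma id_measurable_lebesgue: "(\<lambda>x. x) \<in> borel_measurable (lebesgue :: 'a::euclidean_space measure)"
  by (intro measurable_completion) simp

text \<open>A projection lands in the completed sigma-algebra; composing with the identity into
  \<open>borel\<close> lets Borel functions such as \<open>norm (x - y)\<close> be measured on
  products of Lebesgue spaces.\<close>

lemma fst_snd_borel_measurable_lebesgue [measurable]:
  "fst \<in> borel_measurable (lebesgue \<Otimes>\<^sub>M M :: ('a::euclidean_space \<times> 'b) measure)"
  "snd \<in> borel_measurable (M \<Otimes>\<^sub>M lebesgue :: ('b \<times> 'a) measure)"
  by (rule measurable_compose[OF measurable_fst id_measurable_lebesgue]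
      measurable_compose[OF measurable_snd id_measurable_lebesgue])+

lemma measurable_kernel [measurable]:
  "(\<lambda>(x, y). ennreal (kernel \<sigma> x y))
    \<in> borel_measurable (lebesgue \<Otimes>\<^sub>M lebesgue)"
  for \<sigma> :: real
  unfolding kernel_def split_beta by measurable

lemma measurable_kernel_left [measurable]:
  "(\<lambda>y. ennreal (kernel \<sigma> x y)) \<in> borel_measurable lebesgue"
  using measurable_compose_Pair1[OF _ measurable_kernel, of x] by simp

lemma measurable_kernel_indicator:
  assumes [measurable]: "A \<in> sets lebesgue"
  shows "(\<lambda>y. ennreal (kernel \<sigma> x y) * indicator A y) \<in> borel_measurable lebesgue"
  by measurable

text \<open>The domain of integration moves with \<open>x\<close>, but only through the distance, so
  its indicator is a product of two jointly measurable factors. The choices \<open>UNIV\<close>,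
  \<open>{..<R}\<close> and \<open>{R..}\<close> for \<open>B\<close> give the inner integrals of
  the full, truncated and tail functionals.\<close>

lemma measurable_kernel_integral:
  fixes A :: "'a::euclidean_space set" and B :: "real set"
  assumes [measurable]: "A \<in> sets lebesgue" "B \<in> sets borel"
  shows "(\<lambda>x. \<integral>\<^sup>+y\<in>{y\<in>A. dist x y \<in> B}. ennreal (kernel \<sigma> x y) \<partial>lebesgue)
    \<in> borel_measurable lebesgue"
proof -
  interpret sigma_finite_measure "lebesgue :: 'a measure" by (rule sigma_finite_lebesgue)
  have "(\<lambda>(x, y). ennreal (kernel \<sigma> x y) * indicator {y\<in>A. dist x y \<in> B} y)
      = (\<lambda>z. (case z of (x, y) \<Rightarrow> ennreal (kernel \<sigma> x y)) *
          (indicator A (snd z) * indicator B (dist (fst z) (snd z))))"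
    by (auto simp: fun_eq_iff indicator_def)
  also have "\<dots> \<in> borel_measurable (lebesgue \<Otimes>\<^sub>M lebesgue)"
    by measurable
  finally show ?thesis
    by (intro borel_measurable_nn_integral) (auto simp: split_beta)
qed

lemma measurable_kernel_integral_variants:
  fixes A :: "'a::euclidean_space set"
  assumes "A \<in> sets lebesgue"
  shows "(\<lambda>x. \<integral>\<^sup>+y\<in>UNIV - A. ennreal (kernel \<sigma> x y) \<partial>lebesgue) \<in> borel_measurable lebesgue"
    and "(\<lambda>x. \<integral>\<^sup>+y\<in>ball x R - A. ennreal (kernel \<sigma> x y) \<partial>lebesgue) \<in> borel_measurable lebesgue"
    and "(\<lambda>x. \<integral>\<^sup>+y\<in>A - ball x R. ennreal (kernel \<sigma> x y) \<partial>lebesgue) \<in> borel_measurable lebesgue"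
proof -
  have c: "- A \<in> sets lebesgue"
    using sets.compl_sets[OF assms] by (simp add: Compl_eq_Diff_UNIV)
  have "{y \<in> -A. dist x y \<in> UNIV} = UNIV - A" "{y \<in> -A. dist x y \<in> {..<R}} = ball x R - A"
      "{y \<in> A. dist x y \<in> {R..}} = A - ball x R" for x
    by auto
  then show "(\<lambda>x. \<integral>\<^sup>+y\<in>UNIV - A. ennreal (kernel \<sigma> x y) \<partial>lebesgue) \<in> borel_measurable lebesgue"
      "(\<lambda>x. \<integral>\<^sup>+y\<in>ball x R - A. ennreal (kernel \<sigma> x y) \<partial>lebesgue) \<in> borel_measurable lebesgue"
      "(\<lambda>x. \<integral>\<^sup>+y\<in>A - ball x R. ennreal (kernel \<sigma> x y) \<partial>lebesgue) \<in> borel_measurable lebesgue"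
    using measurable_kernel_integral[OF c, of UNIV \<sigma>] measurable_kernel_integral[OF c, of "{..<R}" \<sigma>]
      measurable_kernel_integral[OF assms, of "{R..}" \<sigma>]
    by simp_all
qed

section \<open>The integral of the kernel outside a ball\<close>

lemma emeasure_cball_diff_ball:
  fixes x :: "'a::euclidean_space"
  assumes "0 \<le> R" "R \<le> t"
  shows "emeasure lborel (cball x t - ball x R)
    = ennreal (unit_ball_vol (real DIM('a)) * (t ^ DIM('a) - R ^ DIM('a)))"
proof -
  have "emeasure lborel (cball x t - ball x R) = emeasure lborel (cball x t) - emeasure lborel (ball x R)"
    using assms by (intro emeasure_Diff) (auto simp: emeasure_ball)
  also have "\<dots> = ennreal (unit_ball_vol (real DIM('a)) * (t ^ DIM('a) - R ^ DIM('a)))"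
    using assms by (simp add: emeasure_ball emeasure_cball ennreal_minus unit_ball_vol_nonneg right_diff_distrib)
  finally show ?thesis .
qed

text \<open>Fundamental theorem of calculus for the antiderivative \<open>- (t powr - p)\<close>,
  which vanishes at infinity.\<close>

lemma powr_neg_eq_tail_integral:
  fixes p r :: real
  assumes "0 < p" "0 < r"
  shows "ennreal (r powr - p) = (\<integral>\<^sup>+t. ennreal (p * t powr (- p - 1)) * indicator {r..} t \<partial>lborel)"
proof -
  have "(\<integral>\<^sup>+t. ennreal (p * t powr (- p - 1)) * indicator {r..} t \<partial>lborel) = ennreal (0 - (- (r powr - p)))"
  proof (rule nn_integral_FTC_atLeast)
    show "DERIV (\<lambda>t. - (t powr - p)) t :> p * t powr (- p - 1)" if "r \<le> t" for t
      using that assms by (auto intro!: derivative_eq_intros simp: powr_diff field_simps)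
    have "((\<lambda>t::real. t powr - p) \<longlongrightarrow> 0) at_top"
      using assms by (intro tendsto_neg_powr filterlim_ident) auto
    then show "((\<lambda>t. - (t powr - p)) \<longlongrightarrow> 0) at_top"
      using tendsto_minus by fastforce
  qed (use assms in auto)
  then show ?thesis by simp
qed

text \<open>
  In place of polar coordinates, the kernel is written as a tail integral; after exchanging the
  order of integration only volumes of annuli are needed.
\<close>

lemma nn_integral_kernel_outside_ball:
  fixes x :: "'a::euclidean_space"
  assumes \<sigma>: "0 < \<sigma>" and R: "0 < R"
  shows "(\<integral>\<^sup>+y\<in>- ball x R. ennreal (kernel \<sigma> x y) \<partial>lebesgue)
    = ennreal (gamma_full TYPE('a) \<sigma> * R powr - \<sigma>)"
proof -
  define d where "d = DIM('a)"
  define p where "p = real d + \<sigma>"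
  define w where "w = unit_ball_vol (real d)"
  define f where "f = (\<lambda>t::real. ennreal (p * t powr (- p - 1)))"
  have p: "0 < p" using \<sigma> by (simp add: p_def)
  have w: "0 \<le> w" by (simp add: w_def)
  have [measurable]: "f \<in> borel_measurable borel" unfolding f_def by measurable
  have "(\<integral>\<^sup>+y\<in>- ball x R. ennreal (kernel \<sigma> x y) \<partial>lebesgue)
      = (\<integral>\<^sup>+y. ennreal (kernel \<sigma> x y) * indicator (- ball x R) y \<partial>lborel)"
    by (rule nn_integral_completion)
  \<comment> \<open>The first indicator comes from the tail integral, the second from the complement
    of the ball. For fixed \<open>t\<close> they confine \<open>y\<close> to the annulus
    \<open>cball x t - ball x R\<close>.\<close>
  also have "\<dots> = (\<integral>\<^sup>+y. (\<integral>\<^sup>+t. f t * (indicator {dist x y..} t * indicator {R..} (dist x y)) \<partial>lborel) \<partial>lborel)"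
  proof (rule nn_integral_cong)
    fix y
    have k: "kernel \<sigma> x y = dist x y powr - p"
      unfolding kernel_def p_def d_def dist_norm powr_minus_divide ..
    have "ennreal (dist x y powr - p) = (\<integral>\<^sup>+t. f t * indicator {dist x y..} t \<partial>lborel)" if "R \<le> dist x y"
      unfolding f_def using that R p by (intro powr_neg_eq_tail_integral) auto
    then show "ennreal (kernel \<sigma> x y) * indicator (- ball x R) y =
        (\<integral>\<^sup>+t. f t * (indicator {dist x y..} t * indicator {R..} (dist x y)) \<partial>lborel)"
      by (cases "R \<le> dist x y") (auto simp: k)
  qed
  also have "\<dots> = (\<integral>\<^sup>+t. (\<integral>\<^sup>+y. f t * (indicator {dist x y..} t * indicator {R..} (dist x y)) \<partial>lborel) \<partial>lborel)"
  proof (rule lborel_pair.Fubini'[symmetric])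
    \<comment> \<open>Testing \<open>t - dist x y\<close> against the fixed set \<open>{0..}\<close>
      replaces the moving half-line, which makes joint measurability evident.\<close>
    have "(\<lambda>(y, t). f t * (indicator {dist x y..} t * indicator {R..} (dist x y)))
        = (\<lambda>z. f (snd z) * (indicator {0..} (snd z - dist x (fst z)) * indicator {R..} (dist x (fst z))))"
      by (auto simp: fun_eq_iff indicator_def)
    also have "\<dots> \<in> borel_measurable (lborel \<Otimes>\<^sub>M lborel)" by measurable
    finally show "(\<lambda>(y, t). f t * (indicator {dist x y..} t * indicator {R..} (dist x y)))
        \<in> borel_measurable (lborel \<Otimes>\<^sub>M lborel)" .
  qed
  also have "\<dots> = (\<integral>\<^sup>+t. f t * emeasure lborel (cball x t - ball x R) \<partial>lborel)"
  proof (rule nn_integral_cong)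
    fix t
    have "(\<integral>\<^sup>+y. f t * (indicator {dist x y..} t * indicator {R..} (dist x y)) \<partial>lborel)
        = (\<integral>\<^sup>+y. f t * indicator (cball x t - ball x R) y \<partial>lborel)"
      by (intro nn_integral_cong) (auto simp: indicator_def)
    also have "\<dots> = f t * emeasure lborel (cball x t - ball x R)"
      by (intro nn_integral_cmult_indicator) auto
    finally show "(\<integral>\<^sup>+y. f t * (indicator {dist x y..} t * indicator {R..} (dist x y)) \<partial>lborel)
        = f t * emeasure lborel (cball x t - ball x R)" .
  qed
  also have "\<dots> = (\<integral>\<^sup>+t. ennreal (p * t powr (- p - 1) * (w * (t ^ d - R ^ d))) * indicator {R..} t \<partial>lborel)"
  proof (rule nn_integral_cong)
    fix t :: real
    show "f t * emeasure lborel (cball x t - ball x R)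
        = ennreal (p * t powr (- p - 1) * (w * (t ^ d - R ^ d))) * indicator {R..} t"
    proof (cases "R \<le> t")
      case True
      then have "R ^ d \<le> t ^ d" using R by (intro power_mono) auto
      with True R w p show ?thesis
        by (simp add: emeasure_cball_diff_ball f_def d_def[symmetric] w_def[symmetric] ennreal_mult)
    next
      case False
      then have e: "cball x t - ball x R = {}" by auto
      show ?thesis unfolding e using False by simp
    qed
  qed
  \<comment> \<open>Since \<open>t powr (- p - 1) * t ^ d = t powr (- \<sigma> - 1)\<close>, the
    integrand is a difference of two powers of \<open>t\<close>; the function \<open>F\<close> below
    integrates them term by term and vanishes at infinity.\<close>
  also have "\<dots> = ennreal (0 - (w * (R ^ d * R powr - p - p * R powr - \<sigma> / \<sigma>)))"
  proof (rule nn_integral_FTC_atLeast[where F = "\<lambda>t. w * (R ^ d * t powr - p - p * t powr - \<sigma> / \<sigma>)"])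
    show "(\<lambda>t. p * t powr (- p - 1) * (w * (t ^ d - R ^ d))) \<in> borel_measurable borel" by measurable
    fix t assume t: "R \<le> t"
    have t0: "0 < t" using t R by simp
    have "t powr (- p - 1) * t ^ d = t powr (- p - 1) * t powr (real d)"
      using t0 by (simp add: powr_realpow)
    also have "\<dots> = t powr (- \<sigma> - 1)"
      by (simp add: powr_add[symmetric] p_def)
    finally have e: "t powr (- p - 1) * t ^ d = t powr (- \<sigma> - 1)" .
    have "DERIV (\<lambda>t. w * (R ^ d * t powr - p - p * t powr - \<sigma> / \<sigma>)) t :>
        w * (R ^ d * (- p * t powr (- p - 1)) - p * (- \<sigma> * t powr (- \<sigma> - 1)) / \<sigma>)"
      using t0 by (auto intro!: derivative_eq_intros simp: powr_diff mult_ac)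
    also have "w * (R ^ d * (- p * t powr (- p - 1)) - p * (- \<sigma> * t powr (- \<sigma> - 1)) / \<sigma>)
        = p * t powr (- p - 1) * (w * (t ^ d - R ^ d))"
    proof -
      have "p * (- \<sigma> * t powr (- \<sigma> - 1)) / \<sigma> = - p * (t powr (- p - 1) * t ^ d)"
        using \<sigma> by (simp add: e)
      then show ?thesis by (simp only:) (simp add: algebra_simps)
    qed
    finally show "DERIV (\<lambda>t. w * (R ^ d * t powr - p - p * t powr - \<sigma> / \<sigma>)) t :>
        p * t powr (- p - 1) * (w * (t ^ d - R ^ d))" .
    have "R ^ d \<le> t ^ d" using t R by (intro power_mono) auto
    then show "0 \<le> p * t powr (- p - 1) * (w * (t ^ d - R ^ d))"
      using p w by auto
  next
    have "((\<lambda>t::real. t powr - p) \<longlongrightarrow> 0) at_top" "((\<lambda>t::real. t powr - \<sigma>) \<longlongrightarrow> 0) at_top"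
      using p \<sigma> by (auto intro!: tendsto_neg_powr filterlim_ident)
    then have "((\<lambda>t. w * (R ^ d * t powr - p - p * t powr - \<sigma> / \<sigma>)) \<longlongrightarrow>
        w * (R ^ d * 0 - p * 0 / \<sigma>)) at_top"
      using \<sigma> by (intro tendsto_intros) auto
    then show "((\<lambda>t. w * (R ^ d * t powr - p - p * t powr - \<sigma> / \<sigma>)) \<longlongrightarrow> 0) at_top"
      by simp
  qed
  \<comment> \<open>At \<open>t = R\<close> both powers reduce to \<open>R powr - \<sigma>\<close>,
    with total coefficient \<open>w * (p / \<sigma> - 1)\<close>; as
    \<open>p - \<sigma> = d\<close>, this is \<open>gamma_full\<close>.\<close>
  also have "0 - (w * (R ^ d * R powr - p - p * R powr - \<sigma> / \<sigma>)) = gamma_full TYPE('a) \<sigma> * R powr - \<sigma>"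
  proof -
    have "R ^ d * R powr - p = R powr (real d) * R powr - p"
      using R by (simp add: powr_realpow)
    also have "\<dots> = R powr - \<sigma>"
      by (simp add: powr_add[symmetric] p_def)
    finally have e: "R ^ d * R powr - p = R powr - \<sigma>" .
    show ?thesis
      unfolding e gamma_full_def omega_eq d_def[symmetric] w_def[symmetric]
      using \<sigma> by (simp add: p_def field_simps)
  qed
  finally show ?thesis .
qed

section \<open>Self-interaction at distance at least \<open>R\<close>, and the exact formula for the
  renormalized functional\<close>

text \<open>The gap between the truncated and the full renormalized functional. The singularity at
  \<open>x = y\<close> is cut out when \<open>R > 0\<close>.\<close>

definition tail_interaction :: "real \<Rightarrow> real \<Rightarrow> 'a::euclidean_space set \<Rightarrow> ennreal" where
  "tail_interaction \<sigma> R E =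
    (\<integral>\<^sup>+x\<in>E. (\<integral>\<^sup>+y\<in>E - ball x R. ennreal (kernel \<sigma> x y) \<partial>lebesgue) \<partial>lebesgue)"

lemma tail_interaction_antimono: "R \<le> S \<Longrightarrow> tail_interaction \<sigma> S E \<le> tail_interaction \<sigma> R E"
  unfolding tail_interaction_def
  by (intro nn_integral_mono mult_right_mono) (auto simp: indicator_def)

text \<open>Outside the ball the kernel is at most \<open>1 / R powr p\<close>, and the pairs range
  over a subset of the product of \<open>E\<close> with itself. Besides the error bound, this
  provides the finiteness that later allows subtraction.\<close>

lemma tail_interaction_le:
  fixes E :: "'a::euclidean_space set"
  assumes "0 < \<sigma>" "0 < R" and E: "E \<in> lmeasurable"
  shows "tail_interaction \<sigma> R E \<le> ennreal ((measure lebesgue E)\<^sup>2 / R powr (real DIM('a) + \<sigma>))"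
proof -
  define p where "p = real DIM('a) + \<sigma>"
  have [measurable]: "E \<in> sets lebesgue" using E by auto
  have p: "0 < p" using assms by (simp add: p_def add_nonneg_pos)
  have k: "kernel \<sigma> x y \<le> 1 / R powr p" if "R \<le> dist x y" for x y :: 'a
  proof -
    have n: "R \<le> norm (x - y)" using that by (simp add: dist_norm)
    then have "R powr p \<le> norm (x - y) powr p" using assms(2) p by (intro powr_mono2) auto
    moreover have "0 < R powr p" using assms(2) by simp
    ultimately show ?thesis
      unfolding kernel_def p_def[symmetric] by (intro divide_left_mono mult_pos_pos) linarith+
  qed
  have "tail_interaction \<sigma> R E \<le> (\<integral>\<^sup>+x\<in>E. (\<integral>\<^sup>+y\<in>E. ennreal (1 / R powr p) \<partial>lebesgue) \<partial>lebesgue)"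
    unfolding tail_interaction_def
    by (intro nn_integral_mono mult_right_mono) (auto simp: indicator_def intro!: ennreal_leI k)
  also have "\<dots> = ennreal (1 / R powr p) * emeasure lebesgue E * emeasure lebesgue E"
    by (simp add: nn_integral_cmult_indicator)
  also have "\<dots> = ennreal ((measure lebesgue E)\<^sup>2 / R powr p)"
    using E by (simp add: emeasure_eq_measure2 ennreal_mult[symmetric] power2_eq_square)
  finally show ?thesis unfolding p_def .
qed

text \<open>
  For each \<open>x \<in> E\<close>, both sides integrate the kernel over the complement of \<open>E \<inter> ball x R\<close>.
\<close>

lemma H_full_plus_tail_interaction:
  fixes E :: "'a::euclidean_space set"
  assumes "0 < \<sigma>" "0 < R" and [measurable]: "E \<in> sets lebesgue"
  shows "H_full \<sigma> E + tail_interaction \<sigma> R E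
    = H_trunc \<sigma> R E + ennreal (gamma_full TYPE('a) \<sigma> * R powr - \<sigma>) * emeasure lebesgue E"
proof -
  note [measurable] = measurable_kernel_integral_variants[OF assms(3)]
  have inner: "(\<integral>\<^sup>+y\<in>UNIV - E. ennreal (kernel \<sigma> x y) \<partial>lebesgue)
        + (\<integral>\<^sup>+y\<in>E - ball x R. ennreal (kernel \<sigma> x y) \<partial>lebesgue)
      = (\<integral>\<^sup>+y\<in>ball x R - E. ennreal (kernel \<sigma> x y) \<partial>lebesgue)
        + ennreal (gamma_full TYPE('a) \<sigma> * R powr - \<sigma>)" for x
  proof -
    have 1: "UNIV - E \<in> sets lebesgue" "E - ball x R \<in> sets lebesgue"
        "ball x R - E \<in> sets lebesgue" "- ball x R \<in> sets lebesgue"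
      by (auto simp: Compl_eq_Diff_UNIV intro!: sets.Diff)
    note m = this[THEN measurable_kernel_indicator, of \<sigma> x]
    show ?thesis
      \<comment> \<open>The constant is turned back into the integral over
        \<open>- ball x R\<close>, so that each side becomes one integral and the integrands can be
        compared pointwise.\<close>
      unfolding nn_integral_kernel_outside_ball[OF assms(1,2), of x, symmetric]
        nn_integral_add[OF m(1,2), symmetric] nn_integral_add[OF m(3,4), symmetric]
      by (intro nn_integral_cong) (auto simp: indicator_def)
  qed
  have "H_full \<sigma> E + tail_interaction \<sigma> R E
      = (\<integral>\<^sup>+x\<in>E. ((\<integral>\<^sup>+y\<in>UNIV - E. ennreal (kernel \<sigma> x y) \<partial>lebesgue)
        + (\<integral>\<^sup>+y\<in>E - ball x R. ennreal (kernel \<sigma> x y) \<partial>lebesgue)) \<partial>lebesgue)"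
    unfolding H_full_def tail_interaction_def
    by (subst nn_integral_add[symmetric]) (auto simp: distrib_right)
  also have "\<dots> = H_trunc \<sigma> R E + (\<integral>\<^sup>+x\<in>E. ennreal (gamma_full TYPE('a) \<sigma> * R powr - \<sigma>) \<partial>lebesgue)"
    unfolding H_trunc_def inner
    by (subst nn_integral_add[symmetric]) (auto simp: distrib_right)
  finally show ?thesis
    by (simp add: nn_integral_cmult_indicator)
qed

text \<open>Exhibits the constant lost by truncation as the kernel integral outside the
  ball.\<close>

lemma gamma_trunc_eq: "gamma_trunc TYPE('a::euclidean_space) \<sigma> R
    = gamma_full TYPE('a) \<sigma> - gamma_full TYPE('a) \<sigma> * R powr - \<sigma>"
  by (simp add: gamma_trunc_def gamma_full_def right_diff_distrib diff_divide_distrib)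

lemma gamma_full_pos: "0 < \<sigma> \<Longrightarrow> 0 < gamma_full TYPE('a::euclidean_space) \<sigma>"
  by (simp add: gamma_full_def omega_eq)

text \<open>Rearranges \<open>H_full_plus_tail_interaction\<close> by means of
  \<open>gamma_trunc_eq\<close>. All terms except \<open>H_full\<close> and \<open>H_trunc\<close>
  are finite, so these two are finite or infinite together, and no difference of infinities
  arises.\<close>

lemma Hhat_trunc_eq:
  fixes E :: "'a::euclidean_space set"
  assumes "0 < \<sigma>" "0 < R" and E: "E \<in> lmeasurable"
  shows "Hhat_trunc \<sigma> R E = Hhat_full \<sigma> E + enn2ereal (tail_interaction \<sigma> R E)"
proof -
  define c where "c = gamma_full TYPE('a) \<sigma> * R powr - \<sigma>"
  define m where "m = measure lebesgue E"
  have nn: "0 \<le> c" "0 \<le> m"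
    using gamma_full_pos[OF assms(1), where 'a='a] by (auto simp: c_def m_def)
  obtain j where j: "tail_interaction \<sigma> R E = ennreal j" "0 \<le> j"
    using tail_interaction_le[OF assms] by (cases "tail_interaction \<sigma> R E") (auto simp: top_unique)
  have id: "H_full \<sigma> E + ennreal j = H_trunc \<sigma> R E + ennreal (c * m)"
    using H_full_plus_tail_interaction[OF assms(1,2), of E] E nn
    by (simp add: j c_def[symmetric] m_def emeasure_eq_measure2 ennreal_mult)
  show ?thesis
  proof (cases "H_trunc \<sigma> R E")
    case (real h)
    have "H_full \<sigma> E + ennreal j < top"
      unfolding id real by simp
    then obtain h' where h': "H_full \<sigma> E = ennreal h'" "0 \<le> h'"
      by (cases "H_full \<sigma> E") auto
    have "h' + j = h + c * m"
      using id real h' j nn by (simp flip: ennreal_plus)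
    then show ?thesis
      using real h' j
      by (simp add: Hhat_trunc_def Hhat_full_def gamma_trunc_eq c_def[symmetric] m_def[symmetric] algebra_simps)
  next
    \<comment> \<open>As \<open>j\<close> is finite, \<open>id\<close> forces \<open>H_full\<close>
      to be infinite too, and both sides of the claim are infinite.\<close>
    case top
    then have "H_full \<sigma> E = top"
      using id by (cases "H_full \<sigma> E") (auto simp flip: ennreal_plus simp: j)
    with top j show ?thesis
      by (simp add: Hhat_trunc_def Hhat_full_def)
  qed
qed

section \<open>Bounds, monotonicity and limit of the renormalized functionals\<close>

lemma Hhat_trunc_bounds:
  fixes E :: "'a::euclidean_space set"
  assumes "0 < \<sigma>" "0 < R" and E: "E \<in> lmeasurable"
  shows "Hhat_full \<sigma> E \<le> Hhat_trunc \<sigma> R E"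
    and "Hhat_trunc \<sigma> R E
      \<le> Hhat_full \<sigma> E + ereal ((measure lebesgue E)\<^sup>2 / R powr (real DIM('a) + \<sigma>))"
proof -
  show "Hhat_full \<sigma> E \<le> Hhat_trunc \<sigma> R E"
    unfolding Hhat_trunc_eq[OF assms] by (intro ereal_le_add_self) simp
  have "enn2ereal (tail_interaction \<sigma> R E)
      \<le> enn2ereal (ennreal ((measure lebesgue E)\<^sup>2 / R powr (real DIM('a) + \<sigma>)))"
    using tail_interaction_le[OF assms] by (simp only: less_eq_ennreal.rep_eq)
  then show "Hhat_trunc \<sigma> R E
      \<le> Hhat_full \<sigma> E + ereal ((measure lebesgue E)\<^sup>2 / R powr (real DIM('a) + \<sigma>))"
    unfolding Hhat_trunc_eq[OF assms] by (intro add_left_mono) simp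
qed

lemma Hhat_trunc_antimono:
  assumes "0 < \<sigma>" "E \<in> lmeasurable"
  shows "antimono_on {0<..} (\<lambda>R. Hhat_trunc \<sigma> R E)"
proof (rule monotone_onI)
  fix R S :: real
  assume "R \<in> {0<..}" "S \<in> {0<..}" "R \<le> S"
  then show "Hhat_trunc \<sigma> S E \<le> Hhat_trunc \<sigma> R E"
    using assms tail_interaction_antimono[of R S \<sigma> E]
    by (simp add: Hhat_trunc_eq add_left_mono less_eq_ennreal.rep_eq)
qed

lemma Hhat_trunc_tendsto:
  fixes E :: "'a::euclidean_space set"
  assumes "0 < \<sigma>" "E \<in> lmeasurable"
  shows "((\<lambda>R. Hhat_trunc \<sigma> R E) \<longlongrightarrow> Hhat_full \<sigma> E) at_top"
proof (rule tendsto_sandwich)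
  show "\<forall>\<^sub>F R in at_top. Hhat_full \<sigma> E \<le> Hhat_trunc \<sigma> R E"
    using eventually_gt_at_top[of 0] by eventually_elim (simp add: Hhat_trunc_bounds assms)
  show "\<forall>\<^sub>F R in at_top. Hhat_trunc \<sigma> R E
      \<le> Hhat_full \<sigma> E + ereal ((measure lebesgue E)\<^sup>2 / R powr (real DIM('a) + \<sigma>))"
    using eventually_gt_at_top[of 0] by eventually_elim (simp add: Hhat_trunc_bounds assms)
  define p where "p = real DIM('a) + \<sigma>"
  have p: "0 < p" using assms by (simp add: p_def add_nonneg_pos)
  have "((\<lambda>R. (measure lebesgue E)\<^sup>2 * R powr - p) \<longlongrightarrow> (measure lebesgue E)\<^sup>2 * 0) at_top"
    using p by (intro tendsto_intros tendsto_neg_powr filterlim_ident) auto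
  then have "((\<lambda>R. ereal ((measure lebesgue E)\<^sup>2 / R powr p)) \<longlongrightarrow> ereal 0) at_top"
    by (simp add: powr_minus field_simps)
  \<comment> \<open>The error term has a finite limit, so addition passes to the limit even where
    \<open>Hhat_full\<close> is infinite.\<close>
  then have "((\<lambda>R. Hhat_full \<sigma> E + ereal ((measure lebesgue E)\<^sup>2 / R powr p))
      \<longlongrightarrow> Hhat_full \<sigma> E + ereal 0) at_top"
    by (intro tendsto_add_ereal_general tendsto_const) auto
  then show "((\<lambda>R. Hhat_full \<sigma> E + ereal ((measure lebesgue E)\<^sup>2 / R powr (real DIM('a) + \<sigma>)))
      \<longlongrightarrow> Hhat_full \<sigma> E) at_top"
    by (simp add: p_def flip: zero_ereal_def)
qed simp

section \<open>Monotonicity and limit of the truncated functional\<close>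

lemma H_trunc_mono: "R \<le> S \<Longrightarrow> H_trunc \<sigma> R E \<le> H_trunc \<sigma> S E"
  unfolding H_trunc_def
  by (intro nn_integral_mono mult_right_mono) (auto simp: indicator_def)

lemma H_trunc_le_H_full: "H_trunc \<sigma> R E \<le> H_full \<sigma> E"
  unfolding H_trunc_def H_full_def
  by (intro nn_integral_mono mult_right_mono) (auto simp: indicator_def)

text \<open>Balls of natural radius exhaust the space; monotone convergence is applied first in
  \<open>y\<close> for each \<open>x\<close>, then in \<open>x\<close>.\<close>

lemma H_full_eq_SUP_H_trunc:
  fixes E :: "'a::euclidean_space set"
  assumes [measurable]: "E \<in> sets lebesgue"
  shows "H_full \<sigma> E = (SUP n::nat. H_trunc \<sigma> (real n) E)"
proof -
  note [measurable] = measurable_kernel_integral_variants[OF assms]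
  have SUP_ind: "(SUP n::nat. indicator (ball x (real n) - E) y) = (indicator (UNIV - E) y :: ennreal)"
    for x y :: 'a
  proof (rule antisym)
    show "(SUP n::nat. indicator (ball x (real n) - E) y) \<le> (indicator (UNIV - E) y :: ennreal)"
      by (intro SUP_least) (auto simp: indicator_def)
    obtain n :: nat where "dist x y < real n" using reals_Archimedean2 by blast
    then show "(indicator (UNIV - E) y :: ennreal) \<le> (SUP n::nat. indicator (ball x (real n) - E) y)"
      by (intro SUP_upper2[of n]) (auto simp: indicator_def)
  qed
  have inner: "(\<integral>\<^sup>+y\<in>UNIV - E. ennreal (kernel \<sigma> x y) \<partial>lebesgue)
      = (SUP n::nat. \<integral>\<^sup>+y\<in>ball x (real n) - E. ennreal (kernel \<sigma> x y) \<partial>lebesgue)" for x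
    unfolding SUP_ind[of x, symmetric] SUP_mult_left_ennreal
  proof (rule nn_integral_monotone_convergence_SUP)
    show "(\<lambda>y. ennreal (kernel \<sigma> x y) * indicator (ball x (real n) - E) y) \<in> borel_measurable lebesgue" for n
      by (intro measurable_kernel_indicator sets.Diff) auto
  qed (auto simp: incseq_def le_fun_def indicator_def)
  show ?thesis
    unfolding H_full_def H_trunc_def inner SUP_mult_right_ennreal
    by (intro nn_integral_monotone_convergence_SUP)
      (auto simp: incseq_def le_fun_def intro!: mult_right_mono nn_integral_mono,
       auto simp: indicator_def)
qed

text \<open>A level below the supremum is exceeded at some natural radius, hence by monotonicity at
  every larger real radius; from above, \<open>H_full\<close> dominates.\<close>

lemma H_trunc_tendsto:
  assumes "E \<in> sets lebesgue"
  shows "((\<lambda>R. H_trunc \<sigma> R E) \<longlongrightarrow> H_full \<sigma> E) at_top"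
proof (rule order_tendstoI)
  fix a assume "a < H_full \<sigma> E"
  then obtain n :: nat where "a < H_trunc \<sigma> (real n) E"
    unfolding H_full_eq_SUP_H_trunc[OF assms] less_SUP_iff by blast
  then show "\<forall>\<^sub>F R in at_top. a < H_trunc \<sigma> R E"
    by (intro eventually_mono[OF eventually_ge_at_top[of "real n"]]) (rule less_le_trans[OF _ H_trunc_mono])
next
  fix a assume "H_full \<sigma> E < a"
  then show "\<forall>\<^sub>F R in at_top. H_trunc \<sigma> R E < a"
    by (intro always_eventually allI) (rule le_less_trans[OF H_trunc_le_H_full])
qed

section \<open>Consequences of L1 convergence of sets\<close>

text \<open>Indicators of sets of finite measure are integrable, so the nonnegative integral in
  \<open>L1_conv\<close> is a Bochner integral, the form used in the next two lemmas.\<close>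

lemma L1_conv_integral:
  fixes En :: "nat \<Rightarrow> 'a::euclidean_space set"
  assumes "\<And>n. En n \<in> lmeasurable" "E \<in> lmeasurable" "L1_conv En E"
  shows "(\<lambda>n. \<integral>x. \<bar>indicat_real (En n) x - indicat_real E x\<bar> \<partial>lebesgue) \<longlonglongrightarrow> 0"
proof -
  have "(\<integral>\<^sup>+x. ennreal \<bar>indicat_real (En n) x - indicat_real E x\<bar> \<partial>lebesgue)
      = ennreal (\<integral>x. \<bar>indicat_real (En n) x - indicat_real E x\<bar> \<partial>lebesgue)" for n
    using assms(1)[of n] assms(2) by (intro nn_integral_eq_integral) (auto simp: fmeasurable_def)
  then show ?thesis
    using assms(3) unfolding L1_conv_def
    by (subst (asm) ennreal_0[symmetric]) (simp del: ennreal_0)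
qed

lemma L1_conv_measure:
  fixes En :: "nat \<Rightarrow> 'a::euclidean_space set"
  assumes "\<And>n. En n \<in> lmeasurable" "E \<in> lmeasurable" "L1_conv En E"
  shows "(\<lambda>n. measure lebesgue (En n)) \<longlonglongrightarrow> measure lebesgue E"
proof -
  have "norm (measure lebesgue (En n) - measure lebesgue E)
      \<le> (\<integral>x. \<bar>indicat_real (En n) x - indicat_real E x\<bar> \<partial>lebesgue)" for n
  proof -
    have "measure lebesgue (En n) - measure lebesgue E
        = (\<integral>x. indicat_real (En n) x - indicat_real E x \<partial>lebesgue)"
      using assms(1)[of n] assms(2) by (subst Bochner_Integration.integral_diff) (auto simp: fmeasurable_def)
    then show ?thesis
      using integral_abs_bound[of lebesgue "\<lambda>x. indicat_real (En n) x - indicat_real E x"] by simp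
  qed
  then have "(\<lambda>n. measure lebesgue (En n) - measure lebesgue E) \<longlonglongrightarrow> 0"
    by (intro Lim_null_comparison[OF _ L1_conv_integral[OF assms]]) auto
  then show ?thesis
    by (simp add: LIM_zero_iff)
qed

lemma L1_conv_AE_subseq:
  fixes En :: "nat \<Rightarrow> 'a::euclidean_space set"
  assumes "\<And>n. En n \<in> lmeasurable" "E \<in> lmeasurable" "L1_conv En E"
  obtains r :: "nat \<Rightarrow> nat" where "strict_mono r"
    "AE x in lebesgue. \<forall>\<^sub>F n in sequentially. x \<in> En (r n) \<longleftrightarrow> x \<in> E"
proof -
  have "\<exists>r::nat\<Rightarrow>nat. strict_mono r \<and>
      (AE x in lebesgue. (\<lambda>n. indicat_real (En (r n)) x - indicat_real E x) \<longlonglongrightarrow> 0)"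
  proof (rule tendsto_L1_AE_subseq)
    show "integrable lebesgue (\<lambda>x. indicat_real (En n) x - indicat_real E x)" for n
      using assms(1)[of n] assms(2) by (intro Bochner_Integration.integrable_diff) (auto simp: fmeasurable_def)
  qed (use L1_conv_integral[OF assms] in simp)
  then obtain r :: "nat \<Rightarrow> nat" where r: "strict_mono r"
    "AE x in lebesgue. (\<lambda>n. indicat_real (En (r n)) x - indicat_real E x) \<longlonglongrightarrow> 0" by blast
  have "AE x in lebesgue. \<forall>\<^sub>F n in sequentially. x \<in> En (r n) \<longleftrightarrow> x \<in> E"
    using r(2)
  proof eventually_elim
    case (elim x)
    \<comment> \<open>The difference takes only the values -1, 0 and 1, so being below 1 in absolute
      value means that the two memberships agree.\<close>
    then have "\<forall>\<^sub>F n in sequentially. \<bar>indicat_real (En (r n)) x - indicat_real E x\<bar> < 1"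
      using tendstoD[OF elim, of 1] by (simp add: dist_real_def)
    then show ?case
      by eventually_elim (auto simp: indicator_def split: if_splits)
  qed
  with r(1) show ?thesis by (rule that)
qed

section \<open>Lower semicontinuity of the full functional\<close>

text \<open>Fatou's lemma twice: in \<open>y\<close> for every \<open>x\<close>, then in
  \<open>x\<close>. The exceptional null set is discarded in each variable separately.\<close>

lemma H_full_le_liminf_AE:
  fixes En :: "nat \<Rightarrow> 'a::euclidean_space set"
  assumes En [measurable]: "\<And>n. En n \<in> sets lebesgue"
    and ae: "AE x in lebesgue. \<forall>\<^sub>F n in sequentially. x \<in> En n \<longleftrightarrow> x \<in> E"
  shows "H_full \<sigma> E \<le> liminf (\<lambda>n. H_full \<sigma> (En n))"
proof -
  note [measurable] = measurable_kernel_integral_variants[OF En]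
  have inner: "(\<integral>\<^sup>+y\<in>UNIV - E. ennreal (kernel \<sigma> x y) \<partial>lebesgue)
      \<le> liminf (\<lambda>n. \<integral>\<^sup>+y\<in>UNIV - En n. ennreal (kernel \<sigma> x y) \<partial>lebesgue)" for x
  proof -
    have "(\<integral>\<^sup>+y\<in>UNIV - E. ennreal (kernel \<sigma> x y) \<partial>lebesgue)
      \<le> (\<integral>\<^sup>+y. liminf (\<lambda>n. ennreal (kernel \<sigma> x y) * indicator (UNIV - En n) y) \<partial>lebesgue)"
    proof (rule nn_integral_mono_AE)
      show "AE y in lebesgue. ennreal (kernel \<sigma> x y) * indicator (UNIV - E) y
          \<le> liminf (\<lambda>n. ennreal (kernel \<sigma> x y) * indicator (UNIV - En n) y)"
        using ae
      proof eventually_elim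
        case (elim y)
        then have "\<forall>\<^sub>F n in sequentially. ennreal (kernel \<sigma> x y) * indicator (UNIV - E) y
            \<le> ennreal (kernel \<sigma> x y) * indicator (UNIV - En n) y"
          by eventually_elim (auto simp: indicator_def)
        then show ?case by (rule Liminf_bounded)
      qed
    qed
    also have "\<dots> \<le> liminf (\<lambda>n. \<integral>\<^sup>+y\<in>UNIV - En n. ennreal (kernel \<sigma> x y) \<partial>lebesgue)"
      by (intro nn_integral_liminf) measurable
    finally show ?thesis .
  qed
  have "H_full \<sigma> E \<le> (\<integral>\<^sup>+x. liminf (\<lambda>n.
      (\<integral>\<^sup>+y\<in>UNIV - En n. ennreal (kernel \<sigma> x y) \<partial>lebesgue) * indicator (En n) x) \<partial>lebesgue)"
    unfolding H_full_def
  proof (rule nn_integral_mono_AE)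
    show "AE x in lebesgue. (\<integral>\<^sup>+y\<in>UNIV - E. ennreal (kernel \<sigma> x y) \<partial>lebesgue) * indicator E x
        \<le> liminf (\<lambda>n. (\<integral>\<^sup>+y\<in>UNIV - En n. ennreal (kernel \<sigma> x y) \<partial>lebesgue) * indicator (En n) x)"
      using ae
    proof eventually_elim
      case (elim x)
      show ?case
      proof (cases "x \<in> E")
        case True
        \<comment> \<open>Eventually \<open>x\<close> lies in \<open>En n\<close>, so the outer
          indicator is eventually 1 and disappears from the liminf.\<close>
        with elim have "liminf (\<lambda>n. (\<integral>\<^sup>+y\<in>UNIV - En n. ennreal (kernel \<sigma> x y) \<partial>lebesgue) * indicator (En n) x)
            = liminf (\<lambda>n. \<integral>\<^sup>+y\<in>UNIV - En n. ennreal (kernel \<sigma> x y) \<partial>lebesgue)"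
          by (intro Liminf_eq) (auto elim!: eventually_mono)
        with True inner[of x] show ?thesis by simp
      qed simp
    qed
  qed
  also have "\<dots> \<le> liminf (\<lambda>n. H_full \<sigma> (En n))"
    unfolding H_full_def by (intro nn_integral_liminf) measurable
  finally show ?thesis .
qed

lemma H_full_le_liminf:
  fixes En :: "nat \<Rightarrow> 'a::euclidean_space set"
  assumes "\<And>n. En n \<in> lmeasurable" "E \<in> lmeasurable" "L1_conv En E"
  shows "H_full \<sigma> E \<le> liminf (\<lambda>n. H_full \<sigma> (En n))"
proof -
  \<comment> \<open>The first subsequence realizes the liminf as a limit; refining it to an almost
    everywhere convergent one then leaves that value unchanged.\<close>
  obtain s where s: "strict_mono s" "((\<lambda>n. H_full \<sigma> (En n)) \<circ> s) \<longlonglongrightarrow> liminf (\<lambda>n. H_full \<sigma> (En n))"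
    using liminf_subseq_lim by blast
  have "L1_conv (En \<circ> s) E"
    using LIMSEQ_subseq_LIMSEQ[OF assms(3)[unfolded L1_conv_def] s(1)] by (simp add: L1_conv_def o_def)
  then obtain r where r: "strict_mono r"
    "AE x in lebesgue. \<forall>\<^sub>F n in sequentially. x \<in> (En \<circ> s) (r n) \<longleftrightarrow> x \<in> E"
    using L1_conv_AE_subseq[of "En \<circ> s" E] assms(1,2) by auto
  have "H_full \<sigma> E \<le> liminf (\<lambda>n. H_full \<sigma> ((En \<circ> s) (r n)))"
    using assms(1) r(2) by (intro H_full_le_liminf_AE) auto
  also have "\<dots> = liminf (\<lambda>n. H_full \<sigma> (En n))"
    using LIMSEQ_subseq_LIMSEQ[OF s(2) r(1)] by (intro lim_imp_Liminf) (auto simp: o_def)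
  finally show ?thesis .
qed

lemma Hhat_full_le_liminf:
  fixes En :: "nat \<Rightarrow> 'a::euclidean_space set"
  assumes "\<And>n. En n \<in> lmeasurable" "E \<in> lmeasurable" "L1_conv En E"
  shows "Hhat_full \<sigma> E \<le> liminf (\<lambda>n. Hhat_full \<sigma> (En n))"
proof -
  let ?g = "gamma_full TYPE('a) \<sigma>"
  have "enn2ereal (H_full \<sigma> E) \<le> enn2ereal (liminf (\<lambda>n. H_full \<sigma> (En n)))"
    using H_full_le_liminf[OF assms] by (simp add: less_eq_ennreal.rep_eq)
  \<comment> \<open>The embedding \<open>enn2ereal\<close> is continuous and monotone, hence
    commutes with liminf.\<close>
  also have "\<dots> = liminf (\<lambda>n. enn2ereal (H_full \<sigma> (En n)))"
    by (intro Liminf_compose_continuous_mono[symmetric] continuous_on_enn2ereal)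
      (auto simp: mono_def less_eq_ennreal.rep_eq)
  finally have le: "enn2ereal (H_full \<sigma> E) \<le> liminf (\<lambda>n. enn2ereal (H_full \<sigma> (En n)))" .
  have "(\<lambda>n. ereal (- (?g * measure lebesgue (En n)))) \<longlonglongrightarrow> ereal (- (?g * measure lebesgue E))"
    by (intro tendsto_intros L1_conv_measure[OF assms])
  \<comment> \<open>The volume term converges to a finite limit and can therefore be split off the
    liminf.\<close>
  then have "liminf (\<lambda>n. ereal (- (?g * measure lebesgue (En n))) + enn2ereal (H_full \<sigma> (En n)))
      = ereal (- (?g * measure lebesgue E)) + liminf (\<lambda>n. enn2ereal (H_full \<sigma> (En n)))"
    by (intro ereal_liminf_lim_add) auto
  moreover have "Hhat_full \<sigma> A = ereal (- (?g * measure lebesgue A)) + enn2ereal (H_full \<sigma> A)" for A :: "'a set"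
    unfolding Hhat_full_def minus_ereal_def by (simp add: add.commute)
  ultimately show ?thesis
    using le by (simp add: add_left_mono)
qed

section \<open>Gamma-convergence\<close>

lemma Gamma_limit_Hhat:
  assumes "0 < \<sigma>"
  shows "Gamma_limit_at_top (lmeasurable :: 'a::euclidean_space set set) L1_conv (Hhat_trunc \<sigma>) (Hhat_full \<sigma>)"
  unfolding Gamma_limit_at_top_def
proof (intro allI impI conjI ballI)
  fix R :: "nat \<Rightarrow> real" and E :: "'a set" and En
  assume R: "\<forall>n. 0 < R n" and E: "E \<in> lmeasurable" and En: "\<forall>n. En n \<in> lmeasurable" "L1_conv En E"
  have "Hhat_full \<sigma> E \<le> liminf (\<lambda>n. Hhat_full \<sigma> (En n))"
    using En E by (intro Hhat_full_le_liminf) auto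
  also have "\<dots> \<le> liminf (\<lambda>n. Hhat_trunc \<sigma> (R n) (En n))"
    using R En assms by (intro Liminf_mono always_eventually) (auto intro: Hhat_trunc_bounds)
  finally show "Hhat_full \<sigma> E \<le> liminf (\<lambda>n. Hhat_trunc \<sigma> (R n) (En n))" .
next
  fix R :: "nat \<Rightarrow> real" and E :: "'a set"
  assume R: "filterlim R at_top sequentially" and E: "E \<in> lmeasurable"
  have "(\<lambda>n. Hhat_trunc \<sigma> (R n) E) \<longlonglongrightarrow> Hhat_full \<sigma> E"
    using filterlim_compose[OF Hhat_trunc_tendsto[OF assms E] R] .
  then have "limsup (\<lambda>n. Hhat_trunc \<sigma> (R n) E) = Hhat_full \<sigma> E"
    by (intro lim_imp_Limsup) auto
  then show "\<exists>u. (\<forall>n. u n \<in> lmeasurable) \<and> L1_conv u E \<and> limsup (\<lambda>n. Hhat_trunc \<sigma> (R n) (u n)) \<le> Hhat_full \<sigma> E"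
    using E by (intro exI[of _ "\<lambda>_. E"]) (auto simp: L1_conv_def)
qed

section \<open>Monotonicity and limit of the constants, and assembly of all claims\<close>

lemma gamma_trunc_strict_mono:
  assumes "0 < \<sigma>"
  shows "strict_mono_on {0<..} (\<lambda>R. gamma_trunc TYPE('a::euclidean_space) \<sigma> R)"
proof (rule strict_mono_onI)
  fix R S :: real
  assume "R \<in> {0<..}" "S \<in> {0<..}" "R < S"
  then have "S powr - \<sigma> < R powr - \<sigma>"
    using assms by (intro powr_less_mono2_neg) auto
  then show "gamma_trunc TYPE('a) \<sigma> R < gamma_trunc TYPE('a) \<sigma> S"
    using gamma_full_pos[OF assms, where 'a='a] by (simp add: gamma_trunc_eq)
qed

lemma gamma_trunc_tendsto:
  assumes "0 < \<sigma>"
  shows "((\<lambda>R. gamma_trunc TYPE('a::euclidean_space) \<sigma> R) \<longlongrightarrow> gamma_full TYPE('a) \<sigma>) at_top"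
proof -
  have "((\<lambda>R. gamma_full TYPE('a) \<sigma> - gamma_full TYPE('a) \<sigma> * R powr - \<sigma>)
      \<longlongrightarrow> gamma_full TYPE('a) \<sigma> - gamma_full TYPE('a) \<sigma> * 0) at_top"
    using assms by (intro tendsto_intros tendsto_neg_powr filterlim_ident) auto
  then show ?thesis by (simp add: gamma_trunc_eq)
qed

theorem proposition2p2:
  fixes \<sigma> :: real
  assumes "0 < \<sigma>" and "\<sigma> < 1"
  shows
    "(\<forall>E :: 'a::euclidean_space set. E \<in> sets lebesgue \<longrightarrow>
        mono_on {0<..} (\<lambda>R. H_trunc \<sigma> R E) \<and>
        ((\<lambda>R. H_trunc \<sigma> R E) \<longlongrightarrow> H_full \<sigma> E) at_top) \<and>
     strict_mono_on {0<..} (\<lambda>R. gamma_trunc TYPE('a) \<sigma> R) \<and>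
     ((\<lambda>R. gamma_trunc TYPE('a) \<sigma> R) \<longlongrightarrow> gamma_full TYPE('a) \<sigma>) at_top \<and>
     (\<forall>E :: 'a set. E \<in> lmeasurable \<longrightarrow>
        ((\<lambda>R. Hhat_trunc \<sigma> R E) \<longlongrightarrow> Hhat_full \<sigma> E) at_top) \<and>
     (\<forall>E :: 'a set. E \<in> lmeasurable \<longrightarrow>
        antimono_on {0<..} (\<lambda>R. Hhat_trunc \<sigma> R E)) \<and>
     (\<forall>R > 1. \<forall>E :: 'a set. E \<in> lmeasurable \<longrightarrow>
        Hhat_full \<sigma> E \<le> Hhat_trunc \<sigma> R E \<and>
        Hhat_trunc \<sigma> R E
          \<le> Hhat_full \<sigma> E + ereal ((measure lebesgue E)\<^sup>2 / R powr (real DIM('a) + \<sigma>))) \<and>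
     Gamma_limit_at_top (lmeasurable :: 'a set set) L1_conv (Hhat_trunc \<sigma>) (Hhat_full \<sigma>)"
  using assms(1)
  by (auto intro: H_trunc_tendsto Hhat_trunc_tendsto Hhat_trunc_antimono Hhat_trunc_bounds
      Gamma_limit_Hhat gamma_trunc_strict_mono gamma_trunc_tendsto monotone_onI H_trunc_mono)

end
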